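(* Let $A\in\mathbb{R}^{m\times n}$ and $b\in\mathbb{R}^m$. Assume that $\delta>0$ and $\eta>1$, and let $\mu=\mu_\ell>0$ satisfy $$b^*(\mu AA^*+I)^{-2\ell}b=\eta^2\delta^2$$ for some $\ell\ge 1$. Then $\mu_\ell$ is a decreasing function of $\ell$.
   Context: The superscript $^*$ denotes transposition, $I$ is the identity matrix of suitable order, and $\ell$ is an integer (the number of iterations). The left-hand side of the displayed equation equals the squared Euclidean norm of the residual $b-Ax_{\ell,\mu}$, where $x_{\ell,\mu}=\sum_{j=1}^{\ell}\mu^{-(j-1)}(A^*A+\mu^{-1}I)^{-j}A^*b$ is the $\ell$th iterated Tikhonov approximate solution of $Ax=b$ with regularization parameter $\mu>0$ (and the identity as regularization matrix). The displayed equation is the discrepancy principle for $x_{\ell,\mu}$; there $\delta$ plays the role of a known bound for the Euclidean norm of the error in the data vector $b$, and $\eta$ is a user-specified parameter.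
   Formalization: The formal theorem additionally assumes A^*b ≠ 0; if A^*b = 0, the equation either has no solution or (when the norm of b is ηδ) holds for every μ > 0 and every ℓ, so μ_ℓ is not determined and need not decrease. *)

theory Defs
  imports "HOL-Analysis.Analysis"
begin

text \<open>
  Powers with respect to the matrix product \<open>(**)\<close>. The overloaded \<open>(^)\<close> is not usable here: the
  multiplication of type \<open>vec\<close> is componentwise.
\<close>

primrec matrix_pow :: "real ^ 'm ^ 'm \<Rightarrow> nat \<Rightarrow> real ^ 'm ^ 'm" where
  "matrix_pow M 0 = mat 1"
| "matrix_pow M (Suc k) = M ** matrix_pow M k"

text \<open>
  \<open>b\<^sup>* (\<mu> A A\<^sup>* + I)\<^bsup>-2\<ell>\<^esup> b\<close>; the negative power is the corresponding power of the inverse.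
  For \<open>\<mu> > 0\<close> the matrix \<open>\<mu> A A\<^sup>* + I\<close> is positive definite, so \<open>matrix_inv\<close> is a genuine inverse.
\<close>

definition discrepancy :: "real ^ 'n ^ 'm \<Rightarrow> real ^ 'm \<Rightarrow> nat \<Rightarrow> real \<Rightarrow> real" where
  "discrepancy A b l \<mu> =
     b \<bullet> (matrix_pow (matrix_inv (\<mu> *\<^sub>R (A ** transpose A) + mat 1)) (2 * l) *v b)"

end

theory Submission
  imports Defs
begin

text \<open>
  Let \<open>S\<^sub>\<mu> = (\<mu> A A\<^sup>* + I)\<^sup>-\<^sup>1\<close>, a symmetric matrix, so that the discrepancy is \<open>\<parallel>S\<^sub>\<mu>\<^sup>\<ell> b\<parallel>\<^sup>2\<close>.
  No spectral decomposition is needed: everything rests on the fact that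
  \<open>\<parallel>y + \<mu> A A\<^sup>* y\<parallel>\<^sup>2 = \<parallel>y\<parallel>\<^sup>2 + 2 \<mu> \<parallel>A\<^sup>* y\<parallel>\<^sup>2 + \<mu>\<^sup>2 \<parallel>A A\<^sup>* y\<parallel>\<^sup>2\<close> increases with \<open>\<mu> \<ge> 0\<close>.
  Hence \<open>S\<^sub>\<mu>\<close> strictly decreases the norm of every vector outside the kernel of \<open>A\<^sup>*\<close>, and the
  discrepancy is strictly decreasing in \<open>\<ell>\<close>. As the matrices \<open>S\<^sub>\<mu>\<close> commute, it is also decreasing
  in \<open>\<mu>\<close>. If now \<open>k < \<ell>\<close> but \<open>\<mu>\<^sub>k \<le> \<mu>\<^sub>\<ell>\<close>, then the discrepancy at \<open>(\<ell>, \<mu>\<^sub>\<ell>)\<close> is at most that at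
  \<open>(\<ell>, \<mu>\<^sub>k)\<close>, hence less than that at \<open>(k, \<mu>\<^sub>k)\<close>, although both equal \<open>\<eta>\<^sup>2 \<delta>\<^sup>2\<close>.
\<close>

lemma matrix_pow_mult_vec: "matrix_pow M k *v x = (((*v) M) ^^ k) x"
  by (induction k) (simp_all add: matrix_vector_mul_assoc [symmetric])

lemma matrix_inv_inverse:
  assumes "invertible M"
  shows "M ** matrix_inv M = mat 1" "matrix_inv M ** M = mat 1"
  using someI_ex [OF assms [unfolded invertible_def]] by (simp_all add: matrix_inv_def)

text \<open>The factors \<open>g\<close> become \<open>f\<close> one at a time: commutation carries
  the new \<open>f\<close> inside the remaining powers of \<open>g\<close>, where the induction
  hypothesis applies at \<open>f x\<close>.\<close>

lemma funpow_norm_mono: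
  fixes f g :: "'a \<Rightarrow> 'a::real_normed_vector"
  assumes comm: "\<And>x. f (g x) = g (f x)" and le: "\<And>x. norm (g x) \<le> norm (f x)"
  shows "norm ((g ^^ k) x) \<le> norm ((f ^^ k) x)"
proof (induction k arbitrary: x)
  case (Suc k)
  have "norm ((g ^^ Suc k) x) \<le> norm (f ((g ^^ k) x))"
    by (simp add: le)
  also have "f ((g ^^ k) x) = (g ^^ k) (f x)"
    by (induction k) (simp_all add: comm)
  also have "norm \<dots> \<le> norm ((f ^^ Suc k) x)"
    using Suc.IH [of "f x"] by (simp add: funpow_swap1)
  finally show ?case .
qed simp

definition tikhonov :: "real ^ 'n ^ 'm \<Rightarrow> real \<Rightarrow> real ^ 'm ^ 'm" where
  "tikhonov A \<mu> = \<mu> *\<^sub>R (A ** transpose A) + mat 1"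

definition resolvent :: "real ^ 'n ^ 'm \<Rightarrow> real \<Rightarrow> real ^ 'm \<Rightarrow> real ^ 'm" where
  "resolvent A \<mu> = (*v) (matrix_inv (tikhonov A \<mu>))"

lemma tikhonov_mult_vec: "tikhonov A \<mu> *v x = x + \<mu> *\<^sub>R (A *v (transpose A *v x))"
  by (simp add: tikhonov_def matrix_vector_mult_add_rdistrib scaleR_matrix_vector_assoc [symmetric]
      matrix_vector_mul_assoc del: transpose_matrix_vector)

lemma inner_mult_transpose: "x \<bullet> (A *v (transpose A *v y)) = (transpose A *v x) \<bullet> (transpose A *v y)"
  for A :: "real ^ 'n ^ 'm"
  by (simp add: dot_lmul_matrix [symmetric])

lemma tikhonov_selfadjoint: "(tikhonov A \<mu> *v x) \<bullet> y = x \<bullet> (tikhonov A \<mu> *v y)"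
  using inner_mult_transpose [of y A x] inner_mult_transpose [of x A y]
  by (simp add: tikhonov_mult_vec inner_add_left inner_add_right inner_commute)

lemma norm_tikhonov_mult_vec:
  "(norm (tikhonov A \<mu> *v x))\<^sup>2 =
     (norm x)\<^sup>2 + 2 * \<mu> * (norm (transpose A *v x))\<^sup>2 + \<mu>\<^sup>2 * (norm (A *v (transpose A *v x)))\<^sup>2"
  using inner_mult_transpose [of x A x]
  unfolding power2_norm_eq_inner tikhonov_mult_vec
  by (simp add: inner_add_left inner_add_right inner_commute algebra_simps power2_eq_square)

lemma norm_tikhonov_mono:
  assumes "0 \<le> s" "s \<le> t"
  shows "norm (tikhonov A s *v x) \<le> norm (tikhonov A t *v x)"
proof (rule power2_le_imp_le)
  show "(norm (tikhonov A s *v x))\<^sup>2 \<le> (norm (tikhonov A t *v x))\<^sup>2"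
    unfolding norm_tikhonov_mult_vec using assms
    by (intro add_mono mult_right_mono power_mono) auto
qed simp

lemma norm_less_norm_tikhonov:
  assumes "0 < \<mu>" "transpose A *v x \<noteq> 0"
  shows "norm x < norm (tikhonov A \<mu> *v x)"
proof (rule power2_less_imp_less)
  have "0 < 2 * \<mu> * (norm (transpose A *v x))\<^sup>2" "0 \<le> \<mu>\<^sup>2 * (norm (A *v (transpose A *v x)))\<^sup>2"
    using assms by simp_all
  then show "(norm x)\<^sup>2 < (norm (tikhonov A \<mu> *v x))\<^sup>2"
    unfolding norm_tikhonov_mult_vec by linarith
qed simp

text \<open>At parameter 0 the matrix is the identity, so monotonicity of the norm in the parameter
  forces a trivial kernel.\<close>

lemma invertible_tikhonov:
  assumes "0 \<le> \<mu>"
  shows "invertible (tikhonov A \<mu>)"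
proof -
  have "x = 0" if "tikhonov A \<mu> *v x = 0" for x
    using norm_tikhonov_mono [of 0 \<mu> A x] assms that by (simp add: tikhonov_mult_vec)
  then show ?thesis
    by (metis invertible_left_inverse matrix_left_invertible_ker)
qed

lemma tikhonov_resolvent [simp]: "0 \<le> \<mu> \<Longrightarrow> tikhonov A \<mu> *v resolvent A \<mu> x = x"
  by (simp add: resolvent_def matrix_vector_mul_assoc invertible_tikhonov matrix_inv_inverse)

lemma resolvent_tikhonov [simp]: "0 \<le> \<mu> \<Longrightarrow> resolvent A \<mu> (tikhonov A \<mu> *v x) = x"
  by (simp add: resolvent_def matrix_vector_mul_assoc invertible_tikhonov matrix_inv_inverse)

lemma tikhonov_commute:
  "tikhonov A s *v (tikhonov A t *v x) = tikhonov A t *v (tikhonov A s *v x)"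
  by (simp add: tikhonov_mult_vec matrix_vector_right_distrib matrix_vector_mult_scaleR algebra_simps)

lemma tikhonov_resolvent_commute:
  "0 \<le> t \<Longrightarrow> tikhonov A s *v resolvent A t x = resolvent A t (tikhonov A s *v x)"
  by (metis tikhonov_resolvent resolvent_tikhonov tikhonov_commute)

lemma resolvent_commute:
  "0 \<le> s \<Longrightarrow> 0 \<le> t \<Longrightarrow> resolvent A s (resolvent A t x) = resolvent A t (resolvent A s x)"
  by (metis tikhonov_resolvent resolvent_tikhonov tikhonov_resolvent_commute)

lemma resolvent_selfadjoint: "0 \<le> \<mu> \<Longrightarrow> resolvent A \<mu> x \<bullet> y = x \<bullet> resolvent A \<mu> y"
  by (metis tikhonov_resolvent tikhonov_selfadjoint)

lemma norm_resolvent_antimono: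
  assumes "0 \<le> s" "s \<le> t"
  shows "norm (resolvent A t x) \<le> norm (resolvent A s x)"
proof -
  \<comment> \<open>Both resolvents of \<open>x\<close> are images of one vector, under
    \<open>tikhonov A s\<close> and \<open>tikhonov A t\<close> respectively.\<close>
  have "resolvent A t x = tikhonov A s *v resolvent A t (resolvent A s x)"
    using assms by (simp add: tikhonov_resolvent_commute)
  also have "norm \<dots> \<le> norm (tikhonov A t *v resolvent A t (resolvent A s x))"
    using assms by (rule norm_tikhonov_mono)
  also have "\<dots> = norm (resolvent A s x)"
    using assms by simp
  finally show ?thesis .
qed

text \<open>A resolvent in the kernel of \<open>transpose A\<close> is fixed by
  \<open>tikhonov A \<mu>\<close>, hence equals \<open>x\<close>. This keeps the decrease strict
  along all iterates.\<close>

lemma transpose_resolvent_nonzero: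
  assumes "0 \<le> \<mu>" "transpose A *v x \<noteq> 0"
  shows "transpose A *v resolvent A \<mu> x \<noteq> 0"
proof
  assume "transpose A *v resolvent A \<mu> x = 0"
  with tikhonov_mult_vec [of A \<mu> "resolvent A \<mu> x"] assms(1) have "resolvent A \<mu> x = x"
    by simp
  with \<open>transpose A *v resolvent A \<mu> x = 0\<close> assms(2) show False
    by simp
qed

lemma norm_resolvent_less:
  assumes "0 < \<mu>" "transpose A *v x \<noteq> 0"
  shows "norm (resolvent A \<mu> x) < norm x"
  using norm_less_norm_tikhonov [of \<mu> A "resolvent A \<mu> x"] transpose_resolvent_nonzero [of \<mu> A x] assms
  by simp

lemma discrepancy_eq_norm:
  assumes "0 \<le> \<mu>"
  shows "discrepancy A b l \<mu> = (norm ((resolvent A \<mu> ^^ l) b))\<^sup>2"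
proof -
  \<comment> \<open>This moves half of the \<open>2 * l\<close> factors to the other side of the
    inner product.\<close>
  have adj: "x \<bullet> (resolvent A \<mu> ^^ k) y = (resolvent A \<mu> ^^ k) x \<bullet> y" for k x y
    by (induction k arbitrary: x y)
       (simp_all add: resolvent_selfadjoint [OF assms, symmetric] funpow_swap1)
  have "discrepancy A b l \<mu> = b \<bullet> (resolvent A \<mu> ^^ (l + l)) b"
    by (simp add: discrepancy_def matrix_pow_mult_vec resolvent_def tikhonov_def mult_2)
  then show ?thesis
    by (simp add: funpow_add adj power2_norm_eq_inner)
qed

lemma discrepancy_antimono:
  assumes "0 \<le> s" "s \<le> t"
  shows "discrepancy A b l t \<le> discrepancy A b l s"
  using assms funpow_norm_mono [of "resolvent A s" "resolvent A t" l b]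
  by (simp add: discrepancy_eq_norm resolvent_commute norm_resolvent_antimono power_mono)

lemma discrepancy_strict_antimono:
  assumes "0 < \<mu>" "transpose A *v b \<noteq> 0" "k < l"
  shows "discrepancy A b l \<mu> < discrepancy A b k \<mu>"
proof -
  have nz: "transpose A *v (resolvent A \<mu> ^^ i) b \<noteq> 0" for i
    using assms by (induction i) (simp_all add: transpose_resolvent_nonzero del: transpose_matrix_vector)
  have "discrepancy A b (Suc i) \<mu> < discrepancy A b i \<mu>" for i
    using assms(1) norm_resolvent_less [OF assms(1) nz, of i]
    by (simp add: discrepancy_eq_norm power_strict_mono)
  then show ?thesis
    using assms(3) lift_Suc_mono_less [of "\<lambda>i. - discrepancy A b i \<mu>" k l] by simp
qed

text \<open>\<open>L\<close> collects the iteration numbers for which a parameter is chosen. If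
  \<open>transpose A *v b\<close> were 0, the discrepancy would be constant in both arguments and
  would not determine \<open>\<mu>\<close>.\<close>

theorem corollary4:
  fixes A :: "real ^ 'n ^ 'm" and b :: "real ^ 'm"
    and \<delta> \<eta> :: real and L :: "nat set" and \<mu> :: "nat \<Rightarrow> real"
  assumes "transpose A *v b \<noteq> 0"
    and "\<delta> > 0" and "\<eta> > 1"
    and "\<And>l. l \<in> L \<Longrightarrow> l \<ge> 1"
    and "\<And>l. l \<in> L \<Longrightarrow> \<mu> l > 0"
    and "\<And>l. l \<in> L \<Longrightarrow> discrepancy A b l (\<mu> l) = \<eta>\<^sup>2 * \<delta>\<^sup>2"
  shows "strict_antimono_on L \<mu>"
proof (rule monotone_onI, rule ccontr)
  fix k l
  assume "k \<in> L" "l \<in> L" "k < l" and "\<not> \<mu> l < \<mu> k"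
  then have "discrepancy A b l (\<mu> l) \<le> discrepancy A b l (\<mu> k)"
    using assms(5) [of k] by (intro discrepancy_antimono) auto
  also have "\<dots> < discrepancy A b k (\<mu> k)"
    using assms(1) assms(5) [OF \<open>k \<in> L\<close>] \<open>k < l\<close> by (intro discrepancy_strict_antimono)
  finally show False
    using assms(6) \<open>k \<in> L\<close> \<open>l \<in> L\<close> by simp
qed

end
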